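(* Let $I=[0,1]$ be equipped with an order-preserving metric $\varrho$ compatible with the Euclidean topology. Let $f\colon I\to I$ be continuous and let $x\in I$. Then the equality $$\underline{c}_m(x,\varepsilon)=\overline{c}_m(x,\varepsilon)$$ holds (1) for every $m\in\mathbb{N}$ and every $\varepsilon>0$, if $\omega_f(x)$ is solenoidal; (2) for every $m\in\mathbb{N}$ and all but finitely many $\varepsilon>0$, if $\omega_f(x)$ is finite.
   Context: $\mathbb{N}=\{1,2,\dots\}$. A metric $\varrho$ on a real interval is order-preserving if $\max\{\varrho(x,y),\varrho(y,z)\}<\varrho(x,z)$ for all points $x<y<z$ of the interval. For $m\in\mathbb{N}$, Bowen's metric is $\varrho_m(x,y)=\max\{\varrho(f^i(x),f^i(y)):0\le i<m\}$. For $x\in I$, $n\in\mathbb{N}$, $\varepsilon>0$, the correlation sum is $$C_m(x,n,\varepsilon)=\frac1{n^2}\#\{(i,j):0\le i,j<n,\ \varrho_m(f^i(x),f^j(x))\le\varepsilon\},$$ and $\underline{c}_m(x,\varepsilon)=\liminf_{n\to\infty}C_m(x,n,\varepsilon)$, $\overline{c}_m(x,\varepsilon)=\limsup_{n\to\infty}C_m(x,n,\varepsilon)$. $\omega_f(x)$ is the set of all limit points of the trajectory $(f^n(x))_{n\ge0}$. A compact interval $J\subseteq I$ is $p$-periodic ($p\in\mathbb{N}$) if $f^p(J)=J$ and $f^k(J)$, $0\le k<p$, are pairwise disjoint. The set $\omega_f(x)$ is solenoidal if there are integers $2\le p_0<p_1<\dots$ and nondegenerate closed intervals $J_0\supseteq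 J_1\supseteq\dots$ in $I$ such that every $J_t$ is $p_t$-periodic and $\omega_f(x)\subseteq\bigcap_{t\ge0}\bigsqcup_{i=0}^{p_t-1}f^i(J_t)$. *)

theory Defs
  imports "HOL-Analysis.Analysis"
begin

definition order_preserving_on :: "real set \<Rightarrow> (real \<Rightarrow> real \<Rightarrow> real) \<Rightarrow> bool" where
  "order_preserving_on S \<rho> \<longleftrightarrow>
     (\<forall>x\<in>S. \<forall>y\<in>S. \<forall>z\<in>S. x < y \<and> y < z \<longrightarrow> max (\<rho> x y) (\<rho> y z) < \<rho> x z)"

(* Only meaningful for m \<ge> 1, as Max is unspecified on the empty set. *)
definition bowen_metric ::
  "('a \<Rightarrow> 'a \<Rightarrow> real) \<Rightarrow> ('a \<Rightarrow> 'a) \<Rightarrow> nat \<Rightarrow> 'a \<Rightarrow> 'a \<Rightarrow> real" where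
  "bowen_metric \<rho> f m x y = Max ((\<lambda>i. \<rho> ((f ^^ i) x) ((f ^^ i) y)) ` {0..<m})"

definition correlation_sum ::
  "('a \<Rightarrow> 'a \<Rightarrow> real) \<Rightarrow> ('a \<Rightarrow> 'a) \<Rightarrow> nat \<Rightarrow> 'a \<Rightarrow> nat \<Rightarrow> real \<Rightarrow> real" where
  "correlation_sum \<rho> f m x n \<epsilon> =
     real (card {(i, j). i < n \<and> j < n \<and> bowen_metric \<rho> f m ((f ^^ i) x) ((f ^^ j) x) \<le> \<epsilon>})
       / (real n)\<^sup>2"

(* The limits are taken in ereal, since liminf and limsup require a complete lattice. *)
definition lower_correlation ::
  "('a \<Rightarrow> 'a \<Rightarrow> real) \<Rightarrow> ('a \<Rightarrow> 'a) \<Rightarrow> nat \<Rightarrow> 'a \<Rightarrow> real \<Rightarrow> ereal" where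
  "lower_correlation \<rho> f m x \<epsilon> = liminf (\<lambda>n. ereal (correlation_sum \<rho> f m x n \<epsilon>))"

definition upper_correlation ::
  "('a \<Rightarrow> 'a \<Rightarrow> real) \<Rightarrow> ('a \<Rightarrow> 'a) \<Rightarrow> nat \<Rightarrow> 'a \<Rightarrow> real \<Rightarrow> ereal" where
  "upper_correlation \<rho> f m x \<epsilon> = limsup (\<lambda>n. ereal (correlation_sum \<rho> f m x n \<epsilon>))"

(* Limit points of the trajectory as a sequence, not of its range: the omega-limit set of a
   periodic point is its orbit. *)
definition omega_limit :: "('a::topological_space \<Rightarrow> 'a) \<Rightarrow> 'a \<Rightarrow> 'a set" where
  "omega_limit f x =
     {y. \<exists>r :: nat \<Rightarrow> nat. strict_mono r \<and> (\<lambda>k. (f ^^ r k) x) \<longlonglongrightarrow> y}"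

definition periodic_interval :: "(real \<Rightarrow> real) \<Rightarrow> nat \<Rightarrow> real set \<Rightarrow> bool" where
  "periodic_interval f p J \<longleftrightarrow>
     (\<exists>a b. a \<le> b \<and> J = {a..b}) \<and> J \<subseteq> {0..1} \<and> p \<ge> 1 \<and>
     (f ^^ p) ` J = J \<and> disjoint_family_on (\<lambda>k. (f ^^ k) ` J) {0..<p}"

definition solenoidal :: "(real \<Rightarrow> real) \<Rightarrow> real set \<Rightarrow> bool" where
  "solenoidal f W \<longleftrightarrow>
     (\<exists>(p :: nat \<Rightarrow> nat) (J :: nat \<Rightarrow> real set).
        2 \<le> p 0 \<and> strict_mono p \<and>
        (\<forall>t. \<exists>a b. a < b \<and> J t = {a..b}) \<and> decseq J \<and>
        (\<forall>t. periodic_interval f (p t) (J t)) \<and>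
        W \<subseteq> (\<Inter>t. \<Union>i\<in>{0..<p t}. (f ^^ i) ` J t))"

end

theory Submission
  imports Defs
begin

text \<open>
  If the trajectory eventually follows a cycle of \<open>p\<close> disjoint intervals, then whether
  \<open>\<rho>(f\<^sup>i x, f\<^sup>j x) \<le> \<epsilon>\<close> is decided by the residues of \<open>i\<close> and \<open>j\<close> modulo \<open>p\<close>, except for
  those pairs of intervals on which \<open>\<rho>\<close> takes values on both sides of \<open>\<epsilon>\<close>. As \<open>\<rho>\<close> is order-preserving,
  such pairs cannot be strictly nested, so the sum of the positions of the two intervals determines
  the pair up to symmetry and there are at most \<open>4p\<close> of them among \<open>p\<^sup>2\<close>. Hence
  the upper and lower limits differ by at most \<open>4m/p\<close>. A solenoidal \<open>\<omega>\<close>-limit set is infinite,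
  so it meets the interior of each cycle and the trajectory enters cycles of arbitrarily large period.
  If \<open>\<omega>\<^sub>f(x)\<close> is finite, the trajectory is asymptotic to a periodic orbit and
  only the finitely many distances between its points are exceptional values of \<open>\<epsilon>\<close>.
\<close>

section \<open>Densities of residue classes\<close>

text \<open>The members are \<open>k * p + r\<close>, one for each \<open>k\<close> below the
  ceiling of \<open>(n - r) / p\<close>. The ceiling is written as the floor of a shifted numerator,
  and \<open>r < p\<close> keeps the natural subtraction from truncating.\<close>

lemma card_residue_class:
  fixes n p r :: nat
  assumes "r < p"
  shows "card {i. i < n \<and> i mod p = r} = (n + p - 1 - r) div p"
proof -
  have k: "k < (n + p - 1 - r) div p \<longleftrightarrow> k * p + r < n" for k
  proof -
    have "k < (n + p - 1 - r) div p \<longleftrightarrow> Suc k \<le> (n + p - 1 - r) div p" by auto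
    also have "\<dots> \<longleftrightarrow> Suc k * p \<le> n + p - 1 - r"
      using assms by (intro less_eq_div_iff_mult_less_eq) auto
    also have "\<dots> \<longleftrightarrow> k * p + r < n" using assms unfolding mult_Suc by linarith
    finally show ?thesis .
  qed
  have "{i. i < n \<and> i mod p = r} = (\<lambda>k. k * p + r) ` {..<(n + p - 1 - r) div p}"
  proof (intro equalityI subsetI)
    fix i assume "i \<in> {i. i < n \<and> i mod p = r}"
    then have i: "i div p * p + r = i" "i < n" using div_mult_mod_eq[of i p] by auto
    then have "i div p < (n + p - 1 - r) div p" by (simp only: k)
    then show "i \<in> (\<lambda>k. k * p + r) ` {..<(n + p - 1 - r) div p}"
      using i(1) by (intro image_eqI[of _ _ "i div p"]) simp_all
  next
    fix i assume "i \<in> (\<lambda>k. k * p + r) ` {..<(n + p - 1 - r) div p}"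
    then obtain l where l: "i = l * p + r" "l < (n + p - 1 - r) div p" by auto
    have "i < n" using l(2) unfolding l(1) k .
    moreover have "i mod p = r" using l(1) assms by simp
    ultimately show "i \<in> {i. i < n \<and> i mod p = r}" by simp
  qed
  moreover have "inj_on (\<lambda>k. k * p + r) {..<(n + p - 1 - r) div p}"
    using assms by (auto simp: inj_on_def)
  ultimately show ?thesis by (simp add: card_image)
qed

text \<open>Rounding moves the count away from \<open>n / p\<close> by at most 1, which vanishes
  after division by \<open>n\<close>.\<close>

lemma tendsto_residue_density:
  fixes p r :: nat
  assumes "r < p"
  shows "(\<lambda>n. real (card {i. i < n \<and> i mod p = r}) / real n) \<longlonglongrightarrow> 1 / real p"
proof -
  have p: "0 < p" using assms by auto
  have b: "\<bar>real (card {i. i < n \<and> i mod p = r}) - real n / real p\<bar> \<le> 1" for n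
  proof -
    define q where "q = (n + p - 1 - r) div p"
    have "q * p \<le> n + p - 1 - r" "n + p - 1 - r < q * p + p"
      unfolding q_def using div_mod_decomp[of "n + p - 1 - r" p] mod_less_divisor[OF p, of "n + p - 1 - r"]
      by linarith+
    then have "q * p \<le> n + p" "n \<le> q * p + p" using assms by linarith+
    then have "real q * real p \<le> real n + real p" "real n \<le> real q * real p + real p"
      by (metis of_nat_add of_nat_le_iff of_nat_mult)+
    then show ?thesis
      unfolding card_residue_class[OF assms] q_def[symmetric] using p
      by (simp add: abs_le_iff field_simps)
  qed
  have "(\<lambda>n. real (card {i. i < n \<and> i mod p = r}) / real n - 1 / real p) \<longlonglongrightarrow> 0"
  proof (rule Lim_null_comparison[OF _ lim_inverse_n'])
    show "\<forall>\<^sub>F n in sequentially. norm (real (card {i. i < n \<and> i mod p = r}) / real n - 1 / real p) \<le> 1 / real n"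
      using eventually_gt_at_top[of 0]
    proof eventually_elim
      case (elim n)
      have "real (card {i. i < n \<and> i mod p = r}) / real n - 1 / real p
          = (real (card {i. i < n \<and> i mod p = r}) - real n / real p) / real n"
        using elim p by (simp add: field_simps)
      then show ?case using b[of n] elim by (simp add: abs_divide divide_right_mono)
    qed
  qed
  then show ?thesis by (simp add: LIM_zero_iff)
qed

text \<open>Each element of \<open>A\<close> contributes a product of two residue classes; these
  products are disjoint and each has density \<open>1 / p^2\<close>.\<close>

lemma tendsto_residue_pair_density:
  fixes p :: nat
  assumes "A \<subseteq> {..<p} \<times> {..<p}"
  shows "(\<lambda>n. real (card {(i, j). i < n \<and> j < n \<and> (i mod p, j mod p) \<in> A}) / (real n)\<^sup>2)
           \<longlonglongrightarrow> real (card A) / (real p)\<^sup>2"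
proof -
  define c where "c n r = {i. i < n \<and> i mod p = r}" for n r
  have fA: "finite A" using finite_subset[OF assms] by simp
  have "card {(i, j). i < n \<and> j < n \<and> (i mod p, j mod p) \<in> A}
      = (\<Sum>z\<in>A. card (c n (fst z)) * card (c n (snd z)))" for n
  proof -
    have "{(i, j). i < n \<and> j < n \<and> (i mod p, j mod p) \<in> A} = (\<Union>z\<in>A. c n (fst z) \<times> c n (snd z))"
      by (auto simp: c_def)
    also have "card \<dots> = (\<Sum>z\<in>A. card (c n (fst z) \<times> c n (snd z)))"
      by (rule card_UN_disjoint[OF fA]) (auto simp: c_def prod_eq_iff)
    finally show ?thesis by (simp add: card_cartesian_product)
  qed
  then have eq: "real (card {(i, j). i < n \<and> j < n \<and> (i mod p, j mod p) \<in> A}) / (real n)\<^sup>2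
     = (\<Sum>z\<in>A. (real (card (c n (fst z))) / real n) * (real (card (c n (snd z))) / real n))" for n
    by (simp add: sum_divide_distrib power2_eq_square)
  have "(\<lambda>n. \<Sum>z\<in>A. (real (card (c n (fst z))) / real n) * (real (card (c n (snd z))) / real n))
      \<longlonglongrightarrow> (\<Sum>z\<in>A. (1 / real p) * (1 / real p))"
    unfolding c_def using assms by (intro tendsto_sum tendsto_mult tendsto_residue_density) auto
  then show ?thesis unfolding eq by (simp add: power2_eq_square)
qed

text \<open>\<open>A\<close> is an inner and \<open>B\<close> an outer approximation of
  \<open>R\<close> by residues, valid only from \<open>N\<close> on. Pairs with an index below
  \<open>N\<close> number at most \<open>2 * N * n\<close>, which vanishes after division by the
  square of \<open>n\<close>.\<close>

lemma density_sandwich: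
  fixes R :: "nat \<Rightarrow> nat \<Rightarrow> bool" and p N :: nat
  assumes "A \<subseteq> {..<p} \<times> {..<p}" and "B \<subseteq> {..<p} \<times> {..<p}"
    and AR: "\<And>i j. N \<le> i \<Longrightarrow> N \<le> j \<Longrightarrow> (i mod p, j mod p) \<in> A \<Longrightarrow> R i j"
    and RB: "\<And>i j. N \<le> i \<Longrightarrow> N \<le> j \<Longrightarrow> R i j \<Longrightarrow> (i mod p, j mod p) \<in> B"
  defines "C \<equiv> \<lambda>n. ereal (real (card {(i, j). i < n \<and> j < n \<and> R i j}) / (real n)\<^sup>2)"
  shows "ereal (real (card A) / (real p)\<^sup>2) \<le> liminf C"
    and "limsup C \<le> ereal (real (card B) / (real p)\<^sup>2)"
proof -
  define D where "D A n = {(i, j). i < n \<and> j < n \<and> (i mod p, j mod p) \<in> A}" for A :: "(nat \<times> nat) set" and n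
  define E where "E n = {(i, j). i < n \<and> j < n \<and> R i j}" for n
  define T where "T n = {..<N} \<times> {..<n} \<union> {..<n} \<times> {..<N}" for n
  have fin: "finite (D A n)" "finite (E n)" "finite (T n)" for A n
  proof -
    have sub: "D A n \<subseteq> {..<n} \<times> {..<n}" "E n \<subseteq> {..<n} \<times> {..<n}" by (auto simp: D_def E_def)
    show "finite (D A n)" by (rule finite_subset[OF sub(1)]) simp
    show "finite (E n)" by (rule finite_subset[OF sub(2)]) simp
    show "finite (T n)" by (simp add: T_def)
  qed
  have cT: "card (T n) \<le> 2 * N * n" for n
    unfolding T_def using card_Un_le[of "{..<N} \<times> {..<n}" "{..<n} \<times> {..<N}"]
    by (simp add: card_cartesian_product algebra_simps)
  have "D A n \<subseteq> E n \<union> T n" for n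
  proof clarify
    fix i j assume "(i, j) \<in> D A n" "(i, j) \<notin> T n"
    then show "(i, j) \<in> E n" using AR[of i j] by (auto simp: D_def E_def T_def)
  qed
  then have 1: "card (D A n) \<le> card (E n) + 2 * N * n" for n
    using card_mono[of "E n \<union> T n" "D A n", OF finite_UnI[OF fin(2) fin(3)]] card_Un_le[of "E n" "T n"] cT[of n]
    by (meson add_left_mono le_trans)
  have "E n \<subseteq> D B n \<union> T n" for n
  proof clarify
    fix i j assume "(i, j) \<in> E n" "(i, j) \<notin> T n"
    then show "(i, j) \<in> D B n" using RB[of i j] by (auto simp: D_def E_def T_def)
  qed
  then have 2: "card (E n) \<le> card (D B n) + 2 * N * n" for n
    using card_mono[of "D B n \<union> T n" "E n", OF finite_UnI[OF fin(1) fin(3)]] card_Un_le[of "D B n" "T n"] cT[of n]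
    by (meson add_left_mono le_trans)
  \<comment> \<open>The error term becomes \<open>2 * N / n\<close>; for \<open>n = 0\<close> all
    quotients are 0, as division by zero yields 0.\<close>
  have scale: "x / (real n)\<^sup>2 \<le> y / (real n)\<^sup>2 + 2 * real N / real n" if "x \<le> y + 2 * real N * real n" for x y n
  proof (cases "n = 0")
    case False
    have "x / (real n)\<^sup>2 \<le> (y + 2 * real N * real n) / (real n)\<^sup>2" using that by (simp add: divide_right_mono)
    also have "\<dots> = y / (real n)\<^sup>2 + 2 * real N / real n" using False by (simp add: field_simps power2_eq_square)
    finally show ?thesis .
  qed simp
  have N0: "(\<lambda>n. 2 * real N / real n) \<longlonglongrightarrow> 0" by (rule lim_const_over_n)
  have C: "C n = ereal (real (card (E n)) / (real n)\<^sup>2)" for n by (simp add: C_def E_def)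
  have "(\<lambda>n. ereal (real (card (D A n)) / (real n)\<^sup>2 - 2 * real N / real n)) \<longlonglongrightarrow> ereal (real (card A) / (real p)\<^sup>2 - 0)"
    unfolding D_def by (rule tendsto_ereal[OF tendsto_diff[OF tendsto_residue_pair_density[OF assms(1)] N0]])
  from lim_imp_Liminf[OF sequentially_bot this] have "ereal (real (card A) / (real p)\<^sup>2)
      = liminf (\<lambda>n. ereal (real (card (D A n)) / (real n)\<^sup>2 - 2 * real N / real n))"
    by simp
  also have "\<dots> \<le> liminf C"
  proof (intro Liminf_mono always_eventually allI)
    fix n
    have "real (card (D A n)) \<le> real (card (E n)) + 2 * real N * real n"
      using of_nat_mono[OF 1[of n], where 'a=real] by simp
    from scale[OF this] show "ereal (real (card (D A n)) / (real n)\<^sup>2 - 2 * real N / real n) \<le> C n"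
      by (simp add: C)
  qed
  finally show "ereal (real (card A) / (real p)\<^sup>2) \<le> liminf C" .
  have lim: "(\<lambda>n. ereal (real (card (D B n)) / (real n)\<^sup>2 + 2 * real N / real n)) \<longlonglongrightarrow> ereal (real (card B) / (real p)\<^sup>2 + 0)"
    unfolding D_def by (rule tendsto_ereal[OF tendsto_add[OF tendsto_residue_pair_density[OF assms(2)] N0]])
  have "limsup C \<le> limsup (\<lambda>n. ereal (real (card (D B n)) / (real n)\<^sup>2 + 2 * real N / real n))"
  proof (intro Limsup_mono always_eventually allI)
    fix n
    have "real (card (E n)) \<le> real (card (D B n)) + 2 * real N * real n"
      using of_nat_mono[OF 2[of n], where 'a=real] by simp
    from scale[OF this] show "C n \<le> ereal (real (card (D B n)) / (real n)\<^sup>2 + 2 * real N / real n)"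
      by (simp add: C)
  qed
  also have "\<dots> = ereal (real (card B) / (real p)\<^sup>2)"
    using lim_imp_Limsup[OF sequentially_bot lim] by simp
  finally show "limsup C \<le> ereal (real (card B) / (real p)\<^sup>2)" .
qed

text \<open>Turns the maximum into a bounded quantifier over time shifts; \<open>m \<ge> 1\<close>
  makes the set under \<open>Max\<close> nonempty.\<close>

lemma bowen_metric_orbit_le_iff:
  assumes "m \<ge> 1"
  shows "bowen_metric \<rho> f m ((f ^^ i) x) ((f ^^ j) x) \<le> \<epsilon>
           \<longleftrightarrow> (\<forall>k<m. \<rho> ((f ^^ (i + k)) x) ((f ^^ (j + k)) x) \<le> \<epsilon>)"
proof -
  have "(f ^^ k) ((f ^^ i) x) = (f ^^ (i + k)) x" for i k
    by (simp add: add.commute[of i] funpow_add)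
  then show ?thesis using assms by (auto simp: bowen_metric_def Max_le_iff)
qed

text \<open>Solenoidal sets use this with \<open>A\<close> and \<open>B\<close> that differ by few
  pairs, finite limit sets with \<open>A = B\<close>.\<close>

lemma correlation_bounds:
  fixes p N :: nat
  assumes "m \<ge> 1" and "A \<subseteq> {..<p} \<times> {..<p}" and "B \<subseteq> {..<p} \<times> {..<p}"
    and "\<And>i j. N \<le> i \<Longrightarrow> N \<le> j \<Longrightarrow> (i mod p, j mod p) \<in> A
           \<Longrightarrow> \<forall>k<m. \<rho> ((f ^^ (i + k)) x) ((f ^^ (j + k)) x) \<le> \<epsilon>"
    and "\<And>i j. N \<le> i \<Longrightarrow> N \<le> j \<Longrightarrow> \<forall>k<m. \<rho> ((f ^^ (i + k)) x) ((f ^^ (j + k)) x) \<le> \<epsilon>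
           \<Longrightarrow> (i mod p, j mod p) \<in> B"
  shows "ereal (real (card A) / (real p)\<^sup>2) \<le> lower_correlation \<rho> f m x \<epsilon>"
    and "upper_correlation \<rho> f m x \<epsilon> \<le> ereal (real (card B) / (real p)\<^sup>2)"
  unfolding lower_correlation_def upper_correlation_def correlation_sum_def
    bowen_metric_orbit_le_iff[OF assms(1)]
  using density_sandwich[OF assms(2,3), of N "\<lambda>i j. \<forall>k<m. \<rho> ((f ^^ (i + k)) x) ((f ^^ (j + k)) x) \<le> \<epsilon>"] assms(4,5)
  by blast+

lemma lower_correlation_le_upper: "lower_correlation \<rho> f m x \<epsilon> \<le> upper_correlation \<rho> f m x \<epsilon>"
  unfolding lower_correlation_def upper_correlation_def by (simp add: Liminf_le_Limsup)

section \<open>Omega-limit sets\<close>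

lemma funpow_invariant: "f ` S \<subseteq> S \<Longrightarrow> x \<in> S \<Longrightarrow> (f ^^ n) x \<in> S"
  by (induction n) auto

text \<open>Infinitely many visits to the complement of \<open>V\<close> would accumulate in the
  compact set \<open>S - V\<close> and give a limit point outside \<open>V\<close>.\<close>

lemma omega_limit_attracts:
  fixes f :: "'a::metric_space \<Rightarrow> 'a"
  assumes "compact S" and "\<And>n. (f ^^ n) x \<in> S" and "open V" and "omega_limit f x \<subseteq> V"
  shows "\<forall>\<^sub>F n in sequentially. (f ^^ n) x \<in> V"
proof (rule ccontr)
  define M where "M = {n. (f ^^ n) x \<notin> V}"
  assume "\<not> (\<forall>\<^sub>F n in sequentially. (f ^^ n) x \<in> V)"
  then have "infinite M"
    unfolding M_def cofinite_eq_sequentially[symmetric] eventually_cofinite by simp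
  then have e: "strict_mono (enumerate M)" "\<And>n. enumerate M n \<in> M"
    by (auto simp: strict_mono_enumerate enumerate_in_set)
  have "seq_compact (S - V)"
    using assms by (simp add: compact_diff compact_imp_seq_compact)
  moreover have "\<forall>n. (f ^^ enumerate M n) x \<in> S - V"
    using e(2) assms(2) by (auto simp: M_def)
  ultimately obtain l r where l: "l \<in> S - V" "strict_mono (r :: nat \<Rightarrow> nat)"
    "((\<lambda>n. (f ^^ enumerate M n) x) \<circ> r) \<longlonglongrightarrow> l"
    using seq_compactE[of "S - V" "\<lambda>n. (f ^^ enumerate M n) x"] by metis
  have "l \<in> omega_limit f x"
    unfolding omega_limit_def using l(3) strict_mono_o[OF e(1) l(2)] by (auto simp: o_def)
  then show False using l(1) assms(4) by auto
qed

text \<open>Otherwise the empty set would be an open set containing \<open>omega_limit f x\<close>,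
  and the trajectory would eventually lie in it.\<close>

lemma omega_limit_nonempty:
  fixes f :: "'a::metric_space \<Rightarrow> 'a"
  assumes "compact S" and "\<And>n. (f ^^ n) x \<in> S"
  shows "omega_limit f x \<noteq> {}"
  using omega_limit_attracts[OF assms, of "{}"] by auto

lemma omega_limit_subset:
  fixes f :: "'a::metric_space \<Rightarrow> 'a"
  assumes "closed S" and "\<And>n. (f ^^ n) x \<in> S"
  shows "omega_limit f x \<subseteq> S"
proof
  fix y assume "y \<in> omega_limit f x"
  then obtain r :: "nat \<Rightarrow> nat" where "(\<lambda>k. (f ^^ r k) x) \<longlonglongrightarrow> y" by (auto simp: omega_limit_def)
  then show "y \<in> S" using closed_sequentially[OF assms(1), of "\<lambda>k. (f ^^ r k) x" y] assms(2) by blast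
qed

lemma omega_limit_invariant:
  fixes f :: "'a::metric_space \<Rightarrow> 'a"
  assumes "closed S" and "continuous_on S f" and S: "\<And>n. (f ^^ n) x \<in> S"
    and y: "y \<in> omega_limit f x"
  shows "f y \<in> omega_limit f x"
proof -
  obtain r where r: "strict_mono (r :: nat \<Rightarrow> nat)" "(\<lambda>k. (f ^^ r k) x) \<longlonglongrightarrow> y"
    using y by (auto simp: omega_limit_def)
  have "y \<in> S" using omega_limit_subset[OF assms(1) S] y by auto
  then have "(\<lambda>k. f ((f ^^ r k) x)) \<longlonglongrightarrow> f y"
    using assms S r by (intro continuous_on_tendsto_compose[OF assms(2)]) auto
  then show ?thesis
    using r(1) by (auto simp: omega_limit_def strict_mono_def intro!: exI[of _ "\<lambda>k. Suc (r k)"])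
qed

text \<open>Near a finite \<open>\<omega>\<close>-limit set, the nearest point of the set is moved by \<open>f\<close> exactly as the
  trajectory is, by uniform continuity; so it is eventually periodic by the pigeonhole principle.\<close>

lemma finite_omega_limit_asymptotically_periodic:
  fixes f :: "'a::metric_space \<Rightarrow> 'a"
  assumes S: "compact S" and f: "continuous_on S f" and xS: "\<And>n. (f ^^ n) x \<in> S"
    and fin: "finite (omega_limit f x)"
  obtains p q where "p > 0" and "\<And>i. q i \<in> S" and "\<And>i. q (i mod p) = q i"
    and "(\<lambda>i. dist ((f ^^ i) x) (q i)) \<longlonglongrightarrow> 0"
proof -
  define W where "W = omega_limit f x"
  define y where "y n = (f ^^ n) x" for n
  have ySuc: "y (Suc n) = f (y n)" for n by (simp add: y_def)
  have WS: "W \<subseteq> S" unfolding W_def using omega_limit_subset S xS compact_imp_closed by metis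
  have Wf: "f w \<in> W" if "w \<in> W" for w
    using omega_limit_invariant[OF compact_imp_closed[OF S] f xS] that by (auto simp: W_def)
  obtain d where d: "d > 0" "\<And>u v. u \<in> W \<Longrightarrow> v \<in> W \<Longrightarrow> dist u v < d \<Longrightarrow> u = v"
  proof
    let ?D = "insert 1 ((\<lambda>(u, v). dist u v) ` {(u, v) \<in> W \<times> W. u \<noteq> v})"
    have D: "finite ?D"
      using fin finite_subset[of "{(u, v) \<in> W \<times> W. u \<noteq> v}" "W \<times> W"] by (auto simp: W_def)
    then show "Min ?D > 0" by (subst Min_gr_iff) auto
    show "u = v" if "u \<in> W" "v \<in> W" "dist u v < Min ?D" for u v
    proof (rule ccontr)
      assume "u \<noteq> v"
      then have "dist u v \<in> ?D" using that by auto
      from Min_le[OF D this] that(3) show False by linarith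
    qed
  qed
  have near: "\<forall>\<^sub>F n in sequentially. \<exists>w\<in>W. dist (y n) w < e" if "e > 0" for e
  proof -
    have "\<forall>\<^sub>F n in sequentially. (f ^^ n) x \<in> (\<Union>w\<in>W. ball w e)"
      by (rule omega_limit_attracts[OF S xS]) (use that in \<open>auto simp: W_def\<close>)
    then show ?thesis by (simp add: y_def dist_commute)
  qed
  obtain h where h: "h > 0" "\<And>u v. u \<in> S \<Longrightarrow> v \<in> S \<Longrightarrow> dist v u < h \<Longrightarrow> dist (f v) (f u) < d/3"
    using compact_uniformly_continuous[OF f S, unfolded uniformly_continuous_on_def, rule_format, of "d/3"]
      d(1) by (auto simp: dist_commute)
  \<comment> \<open>Being within \<open>h\<close> controls the error after one application of
    \<open>f\<close>, being within \<open>d/3\<close> the error before it; two errors below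
    \<open>d/3\<close> stay under the separation \<open>d\<close> of \<open>W\<close>.\<close>
  define \<eta> where "\<eta> = min h (d/3)"
  have \<eta>: "\<eta> > 0" "\<eta> \<le> h" "\<eta> \<le> d/3" using h d by (auto simp: \<eta>_def)
  obtain N where N: "\<And>n. n \<ge> N \<Longrightarrow> \<exists>w\<in>W. dist (y n) w < \<eta>"
    using near[OF \<eta>(1)] by (auto simp: eventually_sequentially)
  then obtain w where w: "\<And>n. n \<ge> N \<Longrightarrow> w n \<in> W \<and> dist (y n) (w n) < \<eta>" by metis
  have step: "w (Suc n) = f (w n)" if "n \<ge> N" for n
  proof -
    have "dist (y (Suc n)) (f (w n)) < d/3"
      using h(2)[of "w n" "y n"] w[OF that] xS WS \<eta> ySuc by (auto simp: y_def)
    moreover have "dist (y (Suc n)) (w (Suc n)) < d/3" using w[of "Suc n"] that \<eta> by auto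
    ultimately have "dist (w (Suc n)) (f (w n)) < d"
      using dist_triangle3[of "w (Suc n)" "f (w n)" "y (Suc n)"] d(1) by linarith
    then show ?thesis using w[of "Suc n"] w[OF that] Wf that by (intro d(2)) auto
  qed
  \<comment> \<open>A point of \<open>W\<close> even closer to \<open>y n\<close> is within
    \<open>d\<close> of \<open>w n\<close>, hence equal to it, so the one selection \<open>w\<close>
    works for every \<open>e\<close>.\<close>
  have lim: "(\<lambda>n. dist (y n) (w n)) \<longlonglongrightarrow> 0"
  proof (rule tendstoI)
    fix e :: real assume e: "e > 0"
    have "\<forall>\<^sub>F n in sequentially. \<exists>v\<in>W. dist (y n) v < min e (d/3)"
      using e d by (intro near) auto
    then show "\<forall>\<^sub>F n in sequentially. dist (dist (y n) (w n)) 0 < e"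
      using eventually_ge_at_top[of N]
    proof eventually_elim
      case (elim n)
      then obtain v where v: "v \<in> W" "dist (y n) v < min e (d/3)" by auto
      have "dist (w n) v < d"
        using dist_triangle3[of "w n" v "y n"] w[OF elim(2)] v \<eta> d(1) by (auto simp: dist_commute)
      then have "w n = v" using w[OF elim(2)] v by (intro d(2)) auto
      then show ?case using v by auto
    qed
  qed
  have "\<not> inj_on w {N..}"
  proof
    assume "inj_on w {N..}"
    moreover have "finite (w ` {N..})"
      using w fin by (auto simp: W_def intro!: finite_subset[of "w ` {N..}" "omega_limit f x"])
    ultimately show False using finite_imageD infinite_Ici by blast
  qed
  then obtain a b where ab: "N \<le> a" "a < b" "w a = w b"
    unfolding inj_on_def by (metis atLeast_iff nat_neq_iff)
  define p where "p = b - a"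
  have p: "p > 0" using ab by (simp add: p_def)
  have per: "w (n + p) = w n" if "n \<ge> a" for n
    using that
  proof (induction n rule: dec_induct)
    case base then show ?case using ab by (simp add: p_def)
  next
    case (step n)
    then show ?case using ab \<open>\<And>n. n \<ge> N \<Longrightarrow> w (Suc n) = f (w n)\<close> by simp
  qed
  have perk: "w (n + k * p) = w n" if "n \<ge> a" for n k
  proof (induction k)
    case (Suc k)
    then show ?case using per[of "n + k * p"] that by (simp add: ac_simps)
  qed simp
  \<comment> \<open>The shift is a multiple of \<open>p\<close>, so \<open>q\<close> agrees with
    \<open>w\<close> from \<open>a\<close> on; as \<open>p > 0\<close>, it is also at least
    \<open>a\<close>, so every index falls into the periodic range.\<close>
  define q where "q i = w (i + a * p)" for i
  have ge: "a * p \<ge> a" using p by simp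
  show ?thesis
  proof (rule that[OF p])
    show "q i \<in> S" for i using w[of "i + a * p"] WS ab ge by (auto simp: q_def)
    show "q (i mod p) = q i" for i
      using perk[of "i mod p + a * p" "i div p"] ge
      by (simp add: q_def)
    have "\<forall>\<^sub>F i in sequentially. dist (y i) (w i) = dist ((f ^^ i) x) (q i)"
      using eventually_ge_at_top[of a] by eventually_elim (simp add: q_def perk y_def)
    with lim show "(\<lambda>i. dist ((f ^^ i) x) (q i)) \<longlonglongrightarrow> 0"
      by (rule Lim_transform_eventually)
  qed
qed

section \<open>Pairs of intervals straddling a distance\<close>

text \<open>The intervals are ranked by their order on the line. If one straddling pair lay strictly
  inside another, a distance at most \<open>\<epsilon>\<close> across the outer pair would bound all
  distances across the inner one. So the sum of ranks, which is below \<open>2 * p\<close>, is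
  injective on the pairs listed from left to right; the reversed pairs double the count.\<close>

lemma card_straddling_pairs_le:
  fixes L :: "nat \<Rightarrow> real set"
  assumes "Metric_space S \<rho>" and ord: "order_preserving_on S \<rho>"
    and L: "\<And>r. r < p \<Longrightarrow> L r \<noteq> {} \<and> L r \<subseteq> S \<and> is_interval (L r)"
    and disj: "disjoint_family_on L {..<p}"
  shows "card {(r, s). r < p \<and> s < p \<and> (\<exists>u\<in>L r. \<exists>v\<in>L s. \<rho> u v \<le> \<epsilon>) \<and>
                (\<exists>u\<in>L r. \<exists>v\<in>L s. \<epsilon> < \<rho> u v)} \<le> 4 * p" (is "card ?P \<le> _")
proof -
  interpret Metric_space S \<rho> by fact
  have "\<exists>c. \<forall>r<p. c r \<in> L r" using L by (intro choice) auto
  then obtain c where c: "\<And>r. r < p \<Longrightarrow> c r \<in> L r" by auto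
  \<comment> \<open>One representative per interval fixes the order of all points: a violation
    would, by convexity, put a point of one interval into the other.\<close>
  have sep: "u < v" if "r < p" "s < p" "c r < c s" "u \<in> L r" "v \<in> L s" for r s u v
  proof (rule ccontr)
    assume "\<not> u < v"
    then have "v \<le> c r \<and> c r \<le> c s \<or> c r \<le> v \<and> v \<le> u" using that(3) by linarith
    then have "c r \<in> L s \<or> v \<in> L r"
      using mem_is_interval_1_I[of "L s" v "c s" "c r"] mem_is_interval_1_I[of "L r" "c r" u v]
        that L[of r] L[of s] c[of r] c[of s] by blast
    then show False
      using disjoint_family_onD[OF disj, of r s] that c[of r] by auto
  qed
  have c_inj: "r = s" if "r < p" "s < p" "c r = c s" for r s
    using disjoint_family_onD[OF disj, of r s] that c[of r] c[of s] by auto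
  \<comment> \<open>Ranks replace the real representatives so that the sums take at most
    \<open>2 * p\<close> values.\<close>
  define rk where "rk r = card {q. q < p \<and> c q < c r}" for r
  have rk_le: "rk s \<le> rk r" if "c s \<le> c r" for r s
    unfolding rk_def using that by (intro card_mono) auto
  have rk_less: "rk r < rk s" if "r < p" "c r < c s" for r s
    unfolding rk_def using that by (intro psubset_card_mono) auto
  have rk_bound: "rk r < p" if "r < p" for r
  proof -
    have "{q. q < p \<and> c q < c r} \<subset> {..<p}" using that by auto
    from psubset_card_mono[OF _ this] show ?thesis by (simp add: rk_def)
  qed
  have rk_inj: "r = s" if "r < p" "s < p" "rk r = rk s" for r s
    using that rk_less[of r s] rk_less[of s r] c_inj[of r s] by (metis less_irrefl linorder_less_linear)
  define Q where "Q = {(r, s). (r, s) \<in> ?P \<and> c r \<le> c s}"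
  have fP: "finite ?P" by (rule finite_subset[of _ "{..<p} \<times> {..<p}"]) auto
  have fQ: "finite Q" by (rule finite_subset[OF _ fP]) (auto simp: Q_def)
  have nested: False if Q: "(r, s) \<in> Q" "(r', s') \<in> Q" "rk r < rk r'" "rk s' < rk s" for r s r' s'
  proof -
    have cc: "c r < c r'" "c s' < c s" using rk_le Q(3,4) by (meson not_less)+
    have lt: "r < p" "s < p" "r' < p" "s' < p" "c r' \<le> c s'" using Q by (auto simp: Q_def)
    obtain u v where uv: "u \<in> L r" "v \<in> L s" "\<rho> u v \<le> \<epsilon>" using Q(1) unfolding Q_def by blast
    obtain u' v' where uv': "u' \<in> L r'" "v' \<in> L s'" "\<epsilon> < \<rho> u' v'" using Q(2) unfolding Q_def by blast
    have in_S: "u \<in> S" "v \<in> S" "u' \<in> S" "v' \<in> S" using uv(1,2) uv'(1,2) L lt(1-4) by (meson subsetD)+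
    have o: "u < u'" "u < v'" "u' < v" "v' < v"
      using sep[OF lt(1,3) cc(1) uv(1) uv'(1)] sep[OF lt(1,4) _ uv(1) uv'(2)]
        sep[OF lt(3,2) _ uv'(1) uv(2)] sep[OF lt(4,2) cc(2) uv'(2) uv(2)] cc lt(5) by linarith+
    have inner: "\<rho> a b < \<rho> u v" if "a \<in> S" "b \<in> S" "u < a" "a < b" "b < v" for a b
    proof -
      have "\<rho> a b < \<rho> a v" using ord in_S that by (auto simp: order_preserving_on_def)
      also have "\<rho> a v < \<rho> u v" using ord in_S that by (fastforce simp: order_preserving_on_def)
      finally show ?thesis .
    qed
    \<comment> \<open>\<open>r'\<close> and \<open>s'\<close> may coincide, so the order of
      \<open>u'\<close> and \<open>v'\<close> is open.\<close>
    consider "u' < v'" | "v' < u'" | "u' = v'" by linarith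
    then have "\<rho> u' v' \<le> \<rho> u v"
    proof cases
      case 1 then show ?thesis using inner[of u' v'] in_S o by simp
    next
      case 2 then show ?thesis using inner[of v' u'] in_S o commute[of u' v'] by simp
    next
      case 3 then show ?thesis using in_S by simp
    qed
    then show False using uv uv' by linarith
  qed
  \<comment> \<open>Equal sums with different first ranks would move the two ends in opposite
    directions, which is strict nesting.\<close>
  have "inj_on (\<lambda>(r, s). rk r + rk s) Q"
  proof (rule inj_onI, clarify)
    fix r s r' s' assume a: "(r, s) \<in> Q" "(r', s') \<in> Q" "rk r + rk s = rk r' + rk s'"
    then have "rk r = rk r'" using nested[OF a(1,2)] nested[OF a(2,1)] by (cases "rk r" "rk r'" rule: linorder_cases) auto
    then show "r = r' \<and> s = s'" using a rk_inj by (auto simp: Q_def)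
  qed
  moreover have "(\<lambda>(r, s). rk r + rk s) ` Q \<subseteq> {..<2 * p}"
  proof (rule image_subsetI)
    fix z assume "z \<in> Q"
    then obtain r s where "z = (r, s)" "r < p" "s < p" by (auto simp: Q_def)
    then show "(case z of (r, s) \<Rightarrow> rk r + rk s) \<in> {..<2 * p}"
      using rk_bound[of r] rk_bound[of s] by simp
  qed
  ultimately have cQ: "card Q \<le> 2 * p" using card_inj_on_le[of _ Q "{..<2 * p}"] by fastforce
  have "?P \<subseteq> Q \<union> prod.swap ` Q"
  proof (rule subrelI, clarify)
    fix r s u v u' v'
    assume a: "(r, s) \<notin> prod.swap ` Q" "r < p" "s < p" "u \<in> L r" "v \<in> L s" "\<rho> u v \<le> \<epsilon>"
      "u' \<in> L r" "v' \<in> L s" "\<epsilon> < \<rho> u' v'"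
    have "(s, r) \<notin> Q" using a(1) by force
    moreover have "\<rho> u v = \<rho> v u" "\<rho> u' v' = \<rho> v' u'" by (rule commute)+
    ultimately show "(r, s) \<in> Q" using a(2-) unfolding Q_def
      by simp (metis nle_le)
  qed
  then have "card ?P \<le> card (Q \<union> prod.swap ` Q)" using fQ by (intro card_mono) auto
  also have "\<dots> \<le> card Q + card (prod.swap ` Q)" by (rule card_Un_le)
  also have "\<dots> \<le> card Q + card Q" using card_image_le[OF fQ] by simp
  finally show ?thesis using cQ by linarith
qed

section \<open>Solenoidal sets\<close>

lemma image_funpow_add_period:
  assumes "(f ^^ p) ` J = J"
  shows "(f ^^ (i + k * p)) ` J = (f ^^ i) ` J"
proof (induction k)
  case (Suc k)
  have "(f ^^ (i + Suc k * p)) ` J = (f ^^ (i + k * p)) ` ((f ^^ p) ` J)"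
    by (simp add: image_comp funpow_add[symmetric] ac_simps)
  then show ?case using Suc assms by simp
qed simp

text \<open>Reduces the index modulo the period but leaves the time shift \<open>k\<close>
  unreduced, as needed for residue pairs observed at several times.\<close>

lemma image_funpow_mod_period:
  assumes "(f ^^ p) ` J = J"
  shows "(f ^^ (i mod p + k)) ` J = (f ^^ (i + k)) ` J"
  using image_funpow_add_period[OF assms, of "i mod p + k" "i div p"]
  by (simp add: ac_simps)

lemma continuous_on_funpow:
  assumes "continuous_on S f" "f ` S \<subseteq> S"
  shows "continuous_on S (f ^^ n)"
proof (induction n)
  case (Suc n)
  have "(f ^^ n) ` S \<subseteq> S" by (rule image_subsetI) (rule funpow_invariant[OF assms(2)])
  then show ?case
    using continuous_on_compose[OF Suc continuous_on_subset[OF assms(1)]] by (simp add: o_def)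
qed simp

lemma solenoidalE:
  assumes "solenoidal f W"
  obtains p :: "nat \<Rightarrow> nat" and J where "strict_mono p" and "\<And>t. periodic_interval f (p t) (J t)"
    and "\<And>t. W \<subseteq> (\<Union>i\<in>{0..<p t}. (f ^^ i) ` J t)"
proof -
  obtain p :: "nat \<Rightarrow> nat" and J where "strict_mono p" "\<forall>t. periodic_interval f (p t) (J t)"
    "W \<subseteq> (\<Inter>t. \<Union>i\<in>{0..<p t}. (f ^^ i) ` J t)"
    using assms unfolding solenoidal_def by blast
  then show ?thesis by (intro that[of p J]) blast+
qed

text \<open>Invariance carries a point of the set through every interval of a cycle, so there are at
  least as many points as disjoint intervals, and the periods are unbounded.\<close>

lemma solenoidal_imp_infinite:
  assumes f: "continuous_on {0..1} f" "f ` {0..1} \<subseteq> {0..1}" "x \<in> {0..1}"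
    and sol: "solenoidal f (omega_limit f x)"
  shows "infinite (omega_limit f x)"
proof
  define W where "W = omega_limit f x"
  assume fin: "finite (omega_limit f x)"
  have xS: "(f ^^ n) x \<in> {0..1}" for n using funpow_invariant[OF f(2,3)] .
  obtain p :: "nat \<Rightarrow> nat" and J where p: "strict_mono p" and per: "\<And>t. periodic_interval f (p t) (J t)"
    and WJ: "\<And>t. W \<subseteq> (\<Union>i\<in>{0..<p t}. (f ^^ i) ` J t)"
    unfolding W_def by (fact solenoidalE[OF sol])
  have Wf: "(f ^^ k) y \<in> W" if "y \<in> W" for k y
    by (induction k) (use that omega_limit_invariant[OF _ f(1) xS] in \<open>auto simp: W_def\<close>)
  obtain y where y: "y \<in> W" using omega_limit_nonempty[OF _ xS] by (auto simp: W_def)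
  \<comment> \<open>Strict monotonicity gives \<open>t \<le> p t\<close>, so this cycle has more
    intervals than \<open>W\<close> has points.\<close>
  define t where "t = Suc (card W)"
  have JP: "(f ^^ p t) ` J t = J t" and dj: "disjoint_family_on (\<lambda>k. (f ^^ k) ` J t) {0..<p t}"
    using per[of t] by (auto simp: periodic_interval_def)
  obtain i where i: "i < p t" "y \<in> (f ^^ i) ` J t" using WJ[of t] y by auto
  have "\<exists>z. z \<in> W \<and> z \<in> (f ^^ j) ` J t" for j
  proof (intro exI conjI)
    \<comment> \<open>\<open>p t - i\<close> steps lead from the \<open>i\<close>-th image back to
      \<open>J t\<close>, and \<open>j\<close> more to the \<open>j\<close>-th image.\<close>
    show "(f ^^ (j + (p t - i))) y \<in> W" using Wf y by auto
    have "(f ^^ (j + (p t - i))) y \<in> (f ^^ (j + (p t - i))) ` ((f ^^ i) ` J t)" using i by blast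
    also have "\<dots> = (f ^^ (j + 1 * p t)) ` J t"
      using i by (simp add: image_comp funpow_add[symmetric])
    also have "\<dots> = (f ^^ j) ` J t" by (rule image_funpow_add_period[OF JP])
    finally show "(f ^^ (j + (p t - i))) y \<in> (f ^^ j) ` J t" .
  qed
  then obtain g where g: "\<And>j. g j \<in> W" "\<And>j. g j \<in> (f ^^ j) ` J t" by metis
  have "inj_on g {0..<p t}"
    using g(2) disjoint_family_onD[OF dj] by (metis disjoint_iff inj_onI)
  then have "card {0..<p t} \<le> card W"
    using g(1) fin by (intro card_inj_on_le[of g]) (auto simp: W_def)
  then show False using seq_suble[OF p, of t] by (simp add: t_def)
qed

text \<open>An infinite subset of a finite union of compact intervals meets the interior of one of them.\<close>

lemma trajectory_enters_periodic_interval: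
  assumes f: "continuous_on {0..1} f" "f ` {0..1} \<subseteq> {0..1}"
    and per: "periodic_interval f p J"
    and inf: "infinite (omega_limit f x)"
    and sub: "omega_limit f x \<subseteq> (\<Union>i\<in>{0..<p}. (f ^^ i) ` J)"
  obtains N c where "\<And>i. N \<le> i \<Longrightarrow> (f ^^ i) x \<in> (f ^^ (i + c)) ` J"
proof -
  have J: "\<exists>a b. J = {a..b}" "J \<subseteq> {0..1}" "(f ^^ p) ` J = J" "p \<ge> 1"
    using per by (auto simp: periodic_interval_def)
  \<comment> \<open>Each image is a compact interval, so only its end points can lie outside the
    interior.\<close>
  have fin: "finite ((f ^^ i) ` J - interior ((f ^^ i) ` J))" for i
  proof -
    have "compact J" "connected J" using J(1) by auto
    moreover have "continuous_on J (f ^^ i)"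
      using continuous_on_funpow[OF f] J(2) continuous_on_subset by blast
    ultimately have "compact ((f ^^ i) ` J)" "connected ((f ^^ i) ` J)"
      by (auto intro: compact_continuous_image connected_continuous_image)
    then obtain a b where "(f ^^ i) ` J = {a..b}" using connected_compact_interval_1[of "(f ^^ i) ` J"] by auto
    then show ?thesis by (auto intro: finite_subset[of _ "{a, b}"])
  qed
  have "\<not> omega_limit f x \<subseteq> (\<Union>i\<in>{0..<p}. (f ^^ i) ` J - interior ((f ^^ i) ` J))"
    using inf fin finite_subset by (metis (no_types, lifting) finite_UN finite_atLeastLessThan)
  then obtain y where y: "y \<in> omega_limit f x"
    and not_boundary: "y \<notin> (\<Union>i\<in>{0..<p}. (f ^^ i) ` J - interior ((f ^^ i) ` J))" by (meson subsetI)
  obtain k where "k \<in> {0..<p}" "y \<in> (f ^^ k) ` J" using subsetD[OF sub y] by (rule UN_E)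
  then have k: "y \<in> interior ((f ^^ k) ` J)" using not_boundary by blast
  obtain r where r: "(\<lambda>k. (f ^^ r k) x) \<longlonglongrightarrow> y" using y by (auto simp: omega_limit_def)
  have "\<forall>\<^sub>F n in sequentially. (f ^^ r n) x \<in> interior ((f ^^ k) ` J)"
    using topological_tendstoD[OF r open_interior k] .
  then obtain M where M: "(f ^^ M) x \<in> (f ^^ k) ` J"
    using interior_subset by (fastforce simp: eventually_sequentially)
  show ?thesis
  proof
    fix i assume i: "M \<le> i"
    have "(f ^^ i) x = (f ^^ (i - M)) ((f ^^ M) x)"
      using i funpow_add[of "i - M" M f] by simp
    also have "\<dots> \<in> (f ^^ (i - M)) ` ((f ^^ k) ` J)" using M by blast
    also have "\<dots> = (f ^^ (i - M + k)) ` J" by (simp add: image_comp funpow_add)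
    \<comment> \<open>\<open>M\<close> extra rounds of the cycle turn the subtraction
      \<open>i - M\<close> into an addition, so the offset from \<open>i\<close> becomes a
      constant.\<close>
    also have "\<dots> = (f ^^ (i - M + k + M * p)) ` J" by (rule image_funpow_add_period[OF J(3), symmetric])
    also have "i - M + k + M * p = i + (k + M * (p - 1))"
    proof -
      have "M * p = M * (p - 1) + M" using J(4) by (cases p) auto
      then show ?thesis using i by linarith
    qed
    finally show "(f ^^ i) x \<in> (f ^^ (i + (k + M * (p - 1)))) ` J" .
  qed
qed

text \<open>Adding \<open>c\<close> permutes the residues modulo \<open>p\<close>, and the image
  depends only on the residue.\<close>

lemma disjoint_family_on_periodic_shift:
  assumes "periodic_interval f p J"
  shows "disjoint_family_on (\<lambda>r. (f ^^ (r + c)) ` J) {..<p}"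
proof (unfold disjoint_family_on_def, intro ballI impI)
  have J: "(f ^^ p) ` J = J" and dj: "disjoint_family_on (\<lambda>k. (f ^^ k) ` J) {0..<p}" and p: "p \<ge> 1"
    using assms by (auto simp: periodic_interval_def)
  have mod_less: "(r + c) mod p \<noteq> (s + c) mod p" if "s < r" "r < p" for r s
  proof
    assume "(r + c) mod p = (s + c) mod p"
    then have "p dvd r - s" using that mod_eq_dvd_iff_nat[of "s + c" "r + c" p] by simp
    then show False using that by (auto dest: dvd_imp_le)
  qed
  fix r s assume rs: "r \<in> {..<p}" "s \<in> {..<p}" "r \<noteq> s"
  then have "(r + c) mod p \<noteq> (s + c) mod p" using mod_less[of r s] mod_less[of s r] by fastforce
  then have "(f ^^ ((r + c) mod p)) ` J \<inter> (f ^^ ((s + c) mod p)) ` J = {}"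
    using p by (intro disjoint_family_onD[OF dj]) auto
  then show "(f ^^ (r + c)) ` J \<inter> (f ^^ (s + c)) ` J = {}"
    using image_funpow_mod_period[OF J, of _ 0] by simp
qed

text \<open>A residue pair that leaves closeness undecided straddles \<open>\<epsilon>\<close> at
  one of the \<open>m\<close> time shifts, and each shift accounts for at most \<open>4 * p\<close>
  of the \<open>p^2\<close> pairs.\<close>

lemma periodic_interval_correlation_gap:
  assumes \<rho>: "Metric_space {0..1} \<rho>" "order_preserving_on {0..1} \<rho>"
    and f: "continuous_on {0..1} f" "f ` {0..1} \<subseteq> {0..1}"
    and per: "periodic_interval f p J"
    and orbit: "\<And>i. N \<le> i \<Longrightarrow> (f ^^ i) x \<in> (f ^^ (i + c)) ` J"
    and m: "m \<ge> 1"
  shows "upper_correlation \<rho> f m x \<epsilon> \<le> lower_correlation \<rho> f m x \<epsilon> + ereal (4 * real m / real p)"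
proof -
  define L where "L i = (f ^^ (i + c)) ` J" for i
  have J: "(f ^^ p) ` J = J" "\<exists>a b. a \<le> b \<and> J = {a..b}" "J \<subseteq> {0..1}" "p \<ge> 1"
    using per by (auto simp: periodic_interval_def)
  have L_mod: "L (i mod p + k) = L (i + k)" for i k
    using image_funpow_mod_period[OF J(1), of i "k + c"] by (simp add: L_def ac_simps)
  have L_props: "L i \<noteq> {} \<and> L i \<subseteq> {0..1} \<and> is_interval (L i)" for i
  proof (intro conjI)
    show "L i \<noteq> {}" using J(2) by (auto simp: L_def)
    show "L i \<subseteq> {0..1}" 
      using J(3) funpow_invariant[OF f(2)] unfolding L_def by (intro image_subsetI) blast
    have "connected J" using J(2) by auto
    moreover have "continuous_on J (f ^^ (i + c))"
      using continuous_on_funpow[OF f] J(3) continuous_on_subset by blast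
    ultimately show "is_interval (L i)"
      by (simp add: L_def is_interval_connected_1 connected_continuous_image)
  qed
  \<comment> \<open>\<open>A\<close> holds the residue pairs that force closeness, \<open>B\<close>
    those that allow it at each time shift separately.\<close>
  define A where "A = {(r, s). r < p \<and> s < p \<and> (\<forall>k<m. \<forall>u\<in>L (r + k). \<forall>v\<in>L (s + k). \<rho> u v \<le> \<epsilon>)}"
  define B where "B = {(r, s). r < p \<and> s < p \<and> (\<forall>k<m. \<exists>u\<in>L (r + k). \<exists>v\<in>L (s + k). \<rho> u v \<le> \<epsilon>)}"
  define P where "P k = {(r, s). r < p \<and> s < p \<and> (\<exists>u\<in>L (r + k). \<exists>v\<in>L (s + k). \<rho> u v \<le> \<epsilon>) \<and>
                (\<exists>u\<in>L (r + k). \<exists>v\<in>L (s + k). \<epsilon> < \<rho> u v)}" for k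
  have AB: "A \<subseteq> {..<p} \<times> {..<p}" "B \<subseteq> {..<p} \<times> {..<p}" by (auto simp: A_def B_def)
  have P: "card (P k) \<le> 4 * p" for k
    unfolding P_def
  proof (rule card_straddling_pairs_le[OF \<rho>])
    show "disjoint_family_on (\<lambda>r. L (r + k)) {..<p}"
      using disjoint_family_on_periodic_shift[OF per, of "k + c"] by (simp add: L_def ac_simps)
  qed (rule L_props)
  have fin: "finite A" "finite (P k)" for k
    by (auto simp: A_def P_def intro: finite_subset[of _ "{..<p} \<times> {..<p}"])
  have "B \<subseteq> A \<union> (\<Union>k<m. P k)"
    unfolding A_def B_def P_def by clarsimp (meson lessThan_iff not_le)
  then have "card B \<le> card (A \<union> (\<Union>k<m. P k))" using fin by (intro card_mono) auto
  also have "\<dots> \<le> card A + card (\<Union>k<m. P k)" by (rule card_Un_le)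
  also have "card (\<Union>k<m. P k) \<le> (\<Sum>k<m. card (P k))" by (rule card_UN_le) simp
  also have "\<dots> \<le> m * (4 * p)" using sum_bounded_above[of "{..<m}" "\<lambda>k. card (P k)" "4 * p"] P by simp
  finally have "card B \<le> card A + m * (4 * p)" by simp
  then have "real (card B) \<le> real (card A) + 4 * real m * real p"
    using of_nat_mono[of "card B" "card A + m * (4 * p)", where 'a=real] by (simp add: ac_simps)
  then have "real (card B) / (real p)\<^sup>2 \<le> (real (card A) + 4 * real m * real p) / (real p)\<^sup>2"
    by (rule divide_right_mono) simp
  also have "\<dots> = real (card A) / (real p)\<^sup>2 + 4 * real m / real p"
    using J(4) by (simp add: field_simps power2_eq_square)
  finally have BA: "real (card B) / (real p)\<^sup>2 \<le> real (card A) / (real p)\<^sup>2 + 4 * real m / real p" .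
  have orbitL: "(f ^^ (i + k)) x \<in> L (i mod p + k)" if "N \<le> i" for i k
    using orbit[of "i + k"] that L_mod[of i k] by (simp add: L_def)
  have p: "i mod p < p" for i using J(4) by simp
  have AR: "\<forall>k<m. \<rho> ((f ^^ (i + k)) x) ((f ^^ (j + k)) x) \<le> \<epsilon>"
    if "N \<le> i" "N \<le> j" "(i mod p, j mod p) \<in> A" for i j
    using orbitL that by (auto simp: A_def)
  have RB: "(i mod p, j mod p) \<in> B"
    if "N \<le> i" "N \<le> j" "\<forall>k<m. \<rho> ((f ^^ (i + k)) x) ((f ^^ (j + k)) x) \<le> \<epsilon>" for i j
    unfolding B_def using orbitL[OF that(1)] orbitL[OF that(2)] that(3) p by blast
  note bounds = correlation_bounds[where \<rho> = \<rho> and f = f and x = x and \<epsilon> = \<epsilon> and N = N, OF m AB AR RB]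
  note bounds(2)
  also have "ereal (real (card B) / (real p)\<^sup>2) \<le> ereal (real (card A) / (real p)\<^sup>2) + ereal (4 * real m / real p)"
    using BA by simp
  also have "\<dots> \<le> lower_correlation \<rho> f m x \<epsilon> + ereal (4 * real m / real p)"
    using bounds(1) by (intro add_right_mono)
  finally show ?thesis .
qed

text \<open>The gap \<open>4 * m / p t\<close> becomes arbitrarily small because the periods are
  unbounded. The entry time and the offset may vary with \<open>t\<close>, but the two correlations
  do not.\<close>

lemma solenoidal_correlation:
  assumes \<rho>: "Metric_space {0..1} \<rho>" "order_preserving_on {0..1} \<rho>"
    and f: "continuous_on {0..1} f" "f ` {0..1} \<subseteq> {0..1}" "x \<in> {0..1}"
    and sol: "solenoidal f (omega_limit f x)" and m: "m \<ge> 1"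
  shows "lower_correlation \<rho> f m x \<epsilon> = upper_correlation \<rho> f m x \<epsilon>"
proof (rule antisym[OF lower_correlation_le_upper])
  obtain p :: "nat \<Rightarrow> nat" and J where p: "strict_mono p" and per: "\<And>t. periodic_interval f (p t) (J t)"
    and sub: "\<And>t. omega_limit f x \<subseteq> (\<Union>i\<in>{0..<p t}. (f ^^ i) ` J t)"
    by (fact solenoidalE[OF sol])
  show "upper_correlation \<rho> f m x \<epsilon> \<le> lower_correlation \<rho> f m x \<epsilon>"
  proof (rule ereal_le_epsilon2)
    fix e :: real assume e: "e > 0"
    obtain t where t: "4 * real m / e < real t" using reals_Archimedean2 by blast
    have "0 \<le> 4 * real m / e" using e by simp
    then have "0 < real (p t)" "4 * real m / e < real (p t)" using seq_suble[OF p, of t] t by linarith+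
    then have small: "4 * real m / real (p t) \<le> e" using e by (simp add: field_simps)
    obtain N c where "\<And>i. N \<le> i \<Longrightarrow> (f ^^ i) x \<in> (f ^^ (i + c)) ` J t"
      by (fact trajectory_enters_periodic_interval[OF f(1,2) per solenoidal_imp_infinite[OF f sol] sub])
    then have "upper_correlation \<rho> f m x \<epsilon> \<le> lower_correlation \<rho> f m x \<epsilon> + ereal (4 * real m / real (p t))"
      by (rule periodic_interval_correlation_gap[OF \<rho> f(1,2) per _ m])
    also have "\<dots> \<le> lower_correlation \<rho> f m x \<epsilon> + ereal e"
      using small by (intro add_left_mono) simp
    finally show "upper_correlation \<rho> f m x \<epsilon> \<le> lower_correlation \<rho> f m x \<epsilon> + ereal e" .
  qed
qed

section \<open>Finite omega-limit sets\<close>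

text \<open>The trajectory shadows a periodic sequence \<open>q\<close>. Unless
  \<open>\<epsilon>\<close> is one of the finitely many values \<open>\<rho> (q r) (q s)\<close>,
  small errors do not affect the comparison with \<open>\<epsilon>\<close>, so residues decide it
  and a single set of residue pairs bounds both limits.\<close>

lemma finite_omega_limit_correlation:
  fixes f :: "'a::metric_space \<Rightarrow> 'a"
  assumes "Metric_space S \<rho>" and top: "Metric_space.mtopology S \<rho> = top_of_set S"
    and S: "compact S" and f: "continuous_on S f" "f ` S \<subseteq> S" "x \<in> S"
    and fin: "finite (omega_limit f x)" and m: "m \<ge> 1"
  shows "finite {\<epsilon>. lower_correlation \<rho> f m x \<epsilon> \<noteq> upper_correlation \<rho> f m x \<epsilon>}"
proof -
  interpret Metric_space S \<rho> by fact
  have xS: "(f ^^ n) x \<in> S" for n using funpow_invariant[OF f(2,3)] .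
  obtain p q where p: "p > 0" and qS: "\<And>i. q i \<in> S" and q_mod: "\<And>i. q (i mod p) = q i"
    and q_lim: "(\<lambda>i. dist ((f ^^ i) x) (q i)) \<longlonglongrightarrow> 0"
    by (fact finite_omega_limit_asymptotically_periodic[OF S f(1) xS fin])
  have q_add: "q (i mod p + k) = q (i + k)" for i k
    using q_mod[of "i mod p + k"] q_mod[of "i + k"] by (simp add: mod_add_left_eq)
  \<comment> \<open>The asymptotics are known for \<open>dist\<close>. The common topology puts a
    relative \<open>dist\<close>-ball inside each \<open>\<rho>\<close>-ball around
    \<open>q r\<close>, and by periodicity finitely many \<open>r\<close> suffice for a uniform
    choice.\<close>
  have close: "\<forall>\<^sub>F i in sequentially. \<rho> ((f ^^ i) x) (q i) < e" if e: "e > 0" for e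
  proof -
    have "\<exists>d>0. \<forall>y\<in>S. dist y (q r) < d \<longrightarrow> \<rho> y (q r) < e" for r
    proof -
      have "openin (top_of_set S) (mball (q r) e)" using openin_mball top by metis
      then obtain d where d: "d > 0" "\<And>y. y \<in> S \<Longrightarrow> dist y (q r) < d \<Longrightarrow> y \<in> mball (q r) e"
        using centre_in_mball_iff[of "q r" e] qS[of r] e unfolding openin_euclidean_subtopology_iff by blast
      then show ?thesis by (auto simp: in_mball commute)
    qed
    then obtain d where d: "\<And>r. d r > 0" "\<And>r y. y \<in> S \<Longrightarrow> dist y (q r) < d r \<Longrightarrow> \<rho> y (q r) < e"
      by metis
    have "\<forall>\<^sub>F i in sequentially. \<forall>r\<in>{..<p}. dist ((f ^^ i) x) (q i) < d r"
      using order_tendstoD(2)[OF q_lim d(1)] by (intro eventually_ball_finite) auto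
    then show ?thesis
    proof eventually_elim
      case (elim i)
      then show ?case using d(2)[of "(f ^^ i) x" "i mod p"] xS p q_mod[of i] by simp
    qed
  qed
  define E where "E = (\<lambda>(r, s). \<rho> (q r) (q s)) ` ({..<p} \<times> {..<p})"
  have E: "\<rho> (q i) (q j) \<in> E" for i j
    unfolding E_def using p q_mod[of i] q_mod[of j]
    by (intro image_eqI[of _ _ "(i mod p, j mod p)"]) auto
  have "lower_correlation \<rho> f m x \<epsilon> = upper_correlation \<rho> f m x \<epsilon>" if "\<epsilon> \<notin> E" for \<epsilon>
  proof -
    have "finite E" by (simp add: E_def)
    then obtain g where g: "g > 0" "\<forall>e\<in>E. e \<noteq> \<epsilon> \<longrightarrow> g \<le> dist \<epsilon> e"
      using finite_set_avoid[of E \<epsilon>] by blast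
    have gap: "g \<le> \<bar>\<epsilon> - \<rho> (q i) (q j)\<bar>" for i j
      using g(2) E[of i j] that by (auto simp: dist_real_def)
    \<comment> \<open>Two errors below \<open>g / 2\<close> cannot carry a distance across the gap
      \<open>g\<close> around \<open>\<epsilon>\<close>.\<close>
    obtain N where N: "\<And>i. N \<le> i \<Longrightarrow> \<rho> ((f ^^ i) x) (q i) < g / 2"
      using close[of "g / 2"] g(1) by (auto simp: eventually_sequentially)
    have iff: "\<rho> ((f ^^ i) x) ((f ^^ j) x) \<le> \<epsilon> \<longleftrightarrow> \<rho> (q i) (q j) \<le> \<epsilon>" if "N \<le> i" "N \<le> j" for i j
    proof -
      let ?y = "\<lambda>i. (f ^^ i) x"
      have "\<rho> (?y i) (?y j) \<le> \<rho> (?y i) (q i) + (\<rho> (q i) (q j) + \<rho> (q j) (?y j))"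
        using triangle[of "?y i" "q i" "?y j"] triangle[of "q i" "q j" "?y j"] xS qS by force
      moreover have "\<rho> (q i) (q j) \<le> \<rho> (q i) (?y i) + (\<rho> (?y i) (?y j) + \<rho> (?y j) (q j))"
        using triangle[of "q i" "?y i" "q j"] triangle[of "?y i" "?y j" "q j"] xS qS by force
      ultimately show ?thesis
        using N[OF that(1)] N[OF that(2)] gap[of i j] commute[of "?y i" "q i"] commute[of "?y j" "q j"]
        by linarith
    qed
    define A where "A = {(r, s). r < p \<and> s < p \<and> (\<forall>k<m. \<rho> (q (r + k)) (q (s + k)) \<le> \<epsilon>)}"
    have A: "A \<subseteq> {..<p} \<times> {..<p}" by (auto simp: A_def)
    have R: "(i mod p, j mod p) \<in> A \<longleftrightarrow> (\<forall>k<m. \<rho> ((f ^^ (i + k)) x) ((f ^^ (j + k)) x) \<le> \<epsilon>)"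
      if "N \<le> i" "N \<le> j" for i j
      using iff[of "i + _" "j + _"] that p by (simp add: A_def q_add)
    have "upper_correlation \<rho> f m x \<epsilon> \<le> ereal (real (card A) / (real p)\<^sup>2)"
      by (rule correlation_bounds(2)[OF m A A]) (use R in blast)+
    also have "\<dots> \<le> lower_correlation \<rho> f m x \<epsilon>"
      by (rule correlation_bounds(1)[OF m A A]) (use R in blast)+
    finally show ?thesis using lower_correlation_le_upper by (intro antisym)
  qed
  then have "{\<epsilon>. lower_correlation \<rho> f m x \<epsilon> \<noteq> upper_correlation \<rho> f m x \<epsilon>} \<subseteq> E" by auto
  moreover have "finite E" by (simp add: E_def)
  ultimately show ?thesis by (rule finite_subset)
qed

theorem theoremA:
  fixes \<rho> :: "real \<Rightarrow> real \<Rightarrow> real" and f :: "real \<Rightarrow> real" and x :: real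
  assumes "Metric_space {0..1} \<rho>"
    and "Metric_space.mtopology {0..1} \<rho> = top_of_set {0..1}"
    and "order_preserving_on {0..1} \<rho>"
    and "continuous_on {0..1} f"
    and "f ` {0..1} \<subseteq> {0..1}"
    and "x \<in> {0..1}"
  shows "(solenoidal f (omega_limit f x) \<longrightarrow>
            (\<forall>m\<ge>1. \<forall>\<epsilon>>0. lower_correlation \<rho> f m x \<epsilon> = upper_correlation \<rho> f m x \<epsilon>)) \<and>
         (finite (omega_limit f x) \<longrightarrow>
            (\<forall>m\<ge>1. finite {\<epsilon>. \<epsilon> > 0 \<and> lower_correlation \<rho> f m x \<epsilon> \<noteq> upper_correlation \<rho> f m x \<epsilon>}))"
proof (intro conjI impI allI)
  fix m :: nat and \<epsilon> :: real
  assume "solenoidal f (omega_limit f x)" "1 \<le> m"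
  then show "lower_correlation \<rho> f m x \<epsilon> = upper_correlation \<rho> f m x \<epsilon>"
    using solenoidal_correlation assms by blast
next
  fix m :: nat
  assume "finite (omega_limit f x)" "1 \<le> m"
  then have "finite {\<epsilon>. lower_correlation \<rho> f m x \<epsilon> \<noteq> upper_correlation \<rho> f m x \<epsilon>}"
    using finite_omega_limit_correlation[of "{0..1}" \<rho> f x m] assms by simp
  then show "finite {\<epsilon>. \<epsilon> > 0 \<and> lower_correlation \<rho> f m x \<epsilon> \<noteq> upper_correlation \<rho> f m x \<epsilon>}"
    by (rule rev_finite_subset) auto
qed

end
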